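(* Let $d \geq 1$ and let $\Gamma \subset \mathbb{Z}^d \setminus \{\mathbf{0}\}$ be a rule set on $\mathbb{N}^d$. The following conditions are equivalent. (1) For each $\gamma \in \Gamma$ and all $p, q \in \mathbb{N}^d$, if $p + q - \gamma \in \mathbb{N}^d$ then $p - \gamma \in \mathbb{N}^d$ or $q - \gamma \in \mathbb{N}^d$. (3) Each $\gamma \in \Gamma$ has at most one positive entry, and that entry is at most $1$. (4) For every $\gamma \in \Gamma$, the positive part $\gamma_+$ is a 0-1 vector with at most one entry equal to $1$. (5) In the language of heaps, each move decreases the number of heaps of exactly one size, and the amount of the decrease is $1$; that is, for each $\gamma \in \Gamma$ there is exactly one index $i$ with $\gamma_i > 0$, and for this index $\gamma_i = 1$.
   Context: $\mathbb{N} = \{0,1,2,\ldots\}$. A finite subset $\Gamma \subset \mathbb{Z}^d \setminus \{\mathbf{0}\}$ is a rule set on $\mathbb{N}^d$ if: (a) there is a linear function $\ell : \mathbb{R}^d \to \mathbb{R}$ that is positive on every element of $\Gamma$ and on every nonzero vector of $\mathbb{R}_{\geq 0}^d$; and (b) (tangent cone axiom) for each $i \in \{1,\ldots,d\}$ there is some $\gamma \in \Gamma$ with $\gamma_j \leq 0$ for all $j \neq i$. A move $\gamma \in \Gamma$ takes a position $p \in \mathbb{N}^d$ to $p - \gamma$, and is legal when $p - \gamma \in \mathbb{N}^d$. In heap language, a position $p = (p_1,\ldots,p_d) \in \mathbb{N}^d$ represents a collection of heaps in which exactly $p_i$ heaps have size $i$, so the move $\gamma$ decreases the number of heaps of size $i$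 by $\gamma_i$ if $\gamma_i > 0$, and does not decrease it otherwise. The positive part of $\gamma$ is $\gamma_+ = (\max\{\gamma_1,0\},\ldots,\max\{\gamma_d,0\})$. *)

theory Defs
  imports "HOL-Analysis.Analysis"
begin

text \<open>
  The dimension \<open>d\<close> is \<open>CARD('d)\<close> for a finite index type \<open>'d\<close> (so \<open>d \<ge> 1\<close> holds automatically),
  and $\mathbb{N}^d$ is taken as a subset of $\mathbb{Z}^d$, so that \<open>p - \<gamma>\<close> is genuine integer
  subtraction rather than truncated subtraction.
\<close>

definition positions :: "(int ^ 'd::finite) set" where
  "positions = {p. \<forall>i. 0 \<le> p $ i}"

definition real_vec :: "int ^ 'd::finite \<Rightarrow> real ^ 'd" where
  "real_vec v = (\<chi> i. real_of_int (v $ i))"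

definition rule_set :: "(int ^ 'd::finite) set \<Rightarrow> bool" where
  "rule_set \<Gamma> \<longleftrightarrow>
     finite \<Gamma> \<and> 0 \<notin> \<Gamma> \<and>
     (\<exists>l :: real ^ 'd \<Rightarrow> real. linear l \<and>
        (\<forall>\<gamma>\<in>\<Gamma>. 0 < l (real_vec \<gamma>)) \<and>
        (\<forall>x. (\<forall>i. 0 \<le> x $ i) \<and> x \<noteq> 0 \<longrightarrow> 0 < l x)) \<and>
     (\<forall>i. \<exists>\<gamma>\<in>\<Gamma>. \<forall>j. j \<noteq> i \<longrightarrow> \<gamma> $ j \<le> 0)"

definition pos_part :: "int ^ 'd::finite \<Rightarrow> int ^ 'd" where
  "pos_part \<gamma> = (\<chi> i. max (\<gamma> $ i) 0)"

end

theory Submission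
  imports Defs
begin

text \<open>Every condition becomes the same test on a single move: a positive entry of
  \<open>\<gamma>\<close> equals 1 and no other entry is positive, so the move consumes at most one
  heap. For (3) and (4) this is rewording. For (1), \<open>splitting_iff\<close> tests the smallest
  position admitting \<open>\<gamma>\<close>, its positive part, split as a unit vector plus the
  rest. Condition (5) also asserts that a positive entry exists; \<open>rule_set_pos_entry\<close>
  gets it from the positive functional.\<close>

text \<open>Otherwise \<open>- \<gamma>\<close> is a nonzero vector of the nonnegative orthant, so
  \<open>l\<close> is positive on both \<open>\<gamma>\<close> and \<open>- \<gamma>\<close>,
  against linearity.\<close>

lemma rule_set_pos_entry:
  fixes \<Gamma> :: "(int ^ 'd::finite) set"
  assumes "rule_set \<Gamma>" "\<gamma> \<in> \<Gamma>"
  shows "\<exists>i. \<gamma> $ i > 0"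
proof (rule ccontr)
  assume "\<nexists>i. \<gamma> $ i > 0"
  then have nonpos: "\<gamma> $ i \<le> 0" for i
    by (simp add: not_less)
  have "\<exists>l :: real ^ 'd \<Rightarrow> real. linear l \<and> (\<forall>\<gamma>\<in>\<Gamma>. 0 < l (real_vec \<gamma>)) \<and>
      (\<forall>x. (\<forall>i. 0 \<le> x $ i) \<and> x \<noteq> 0 \<longrightarrow> 0 < l x)"
    using assms(1) by (simp only: rule_set_def)
  then obtain l :: "real ^ 'd \<Rightarrow> real" where l: "linear l" "0 < l (real_vec \<gamma>)"
    "\<And>x. (\<forall>i. 0 \<le> x $ i) \<Longrightarrow> x \<noteq> 0 \<Longrightarrow> 0 < l x"
    using assms(2) by auto
  have "0 \<notin> \<Gamma>"
    using assms(1) by (simp add: rule_set_def)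
  then have "\<gamma> \<noteq> 0"
    using assms(2) by metis
  then have "- real_vec \<gamma> \<noteq> 0"
    by (auto simp: real_vec_def vec_eq_iff)
  moreover have "\<forall>i. 0 \<le> (- real_vec \<gamma>) $ i"
    using nonpos by (simp add: real_vec_def)
  ultimately have "0 < l (- real_vec \<gamma>)"
    by (intro l(3))
  then show False
    using l(2) linear_neg[OF l(1), of "real_vec \<gamma>"] by simp
qed

text \<open>A move consuming one heap finds it in one of the two summands; a move consuming more can
  have its requirements divided between them.\<close>

lemma splitting_iff:
  fixes \<gamma> :: "int ^ 'd::finite"
  shows "(\<forall>p\<in>positions. \<forall>q\<in>positions.
            p + q - \<gamma> \<in> positions \<longrightarrow> p - \<gamma> \<in> positions \<or> q - \<gamma> \<in> positions) \<longleftrightarrow>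
         (\<forall>i. \<gamma> $ i > 0 \<longrightarrow> \<gamma> $ i = 1 \<and> (\<forall>j. j \<noteq> i \<longrightarrow> \<gamma> $ j \<le> 0))"
    (is "?split \<longleftrightarrow> ?unit")
proof
  assume split: ?split
  show ?unit
  proof (intro allI impI)
    fix i assume pos: "\<gamma> $ i > 0"
    \<comment> \<open>\<open>q\<close> is one short of \<open>\<gamma>\<close> in coordinate \<open>i\<close>, so the unit vector \<open>p\<close> alone must admit the move.\<close>
    define p :: "int ^ 'd" where "p = axis i 1"
    define q where "q = pos_part \<gamma> - p"
    \<comment> \<open>Here \<open>p + q\<close> is the positive part of \<open>\<gamma>\<close>,
      which dominates \<open>\<gamma>\<close>; \<open>q\<close> stays nonnegative because
      \<open>\<gamma> $ i\<close> is at least 1.\<close>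
    have "p \<in> positions" "q \<in> positions" "p + q - \<gamma> \<in> positions"
      using pos by (auto simp: positions_def p_def q_def pos_part_def axis_def)
    moreover have "q - \<gamma> \<notin> positions"
      using pos by (auto simp: positions_def p_def q_def pos_part_def axis_def intro!: exI[of _ i])
    ultimately have "p - \<gamma> \<in> positions"
      using split by blast
    \<comment> \<open>The unit vector dominates \<open>\<gamma>\<close>, which bounds every entry at
      once.\<close>
    then have le: "0 \<le> p $ j - \<gamma> $ j" for j
      by (simp add: positions_def)
    have "\<gamma> $ i = 1"
      using pos le[of i] by (simp add: p_def axis_def)
    moreover have "\<gamma> $ j \<le> 0" if "j \<noteq> i" for j
      using that le[of j] by (simp add: p_def axis_def)
    ultimately show "\<gamma> $ i = 1 \<and> (\<forall>j. j \<noteq> i \<longrightarrow> \<gamma> $ j \<le> 0)"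
      by blast
  qed
next
  assume unit: ?unit
  show ?split
  proof (intro ballI impI)
    fix p q assume pq: "p \<in> positions" "q \<in> positions" "p + q - \<gamma> \<in> positions"
    show "p - \<gamma> \<in> positions \<or> q - \<gamma> \<in> positions"
    proof (cases "\<exists>i. \<gamma> $ i > 0")
      case True
      then obtain i where i: "\<gamma> $ i = 1" "\<And>j. j \<noteq> i \<Longrightarrow> \<gamma> $ j \<le> 0"
        using unit by blast
      \<comment> \<open>One heap of size \<open>i\<close> is all that \<open>\<gamma>\<close>
        consumes.\<close>
      have "r - \<gamma> \<in> positions" if "r \<in> positions" "1 \<le> r $ i" for r
        unfolding positions_def
      proof (intro CollectI allI)
        fix j
        have "0 \<le> r $ j"
          using that(1) by (simp add: positions_def)
        then show "0 \<le> (r - \<gamma>) $ j"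
          using that(2) i(1) i(2)[of j] by (cases "j = i") auto
      qed
      moreover have "1 \<le> p $ i \<or> 1 \<le> q $ i"
      proof -
        have "0 \<le> p $ i + q $ i - \<gamma> $ i"
          using pq(3) by (simp add: positions_def)
        then show ?thesis
          using i(1) by linarith
      qed
      ultimately show ?thesis
        using pq by blast
    next
      \<comment> \<open>Such a move only adds heaps, so it is legal everywhere.\<close>
      case False
      then have "\<gamma> $ i \<le> 0" for i
        by (simp add: not_less)
      moreover have "0 \<le> p $ i" for i
        using pq(1) by (simp add: positions_def)
      ultimately have "p - \<gamma> \<in> positions"
        by (simp add: positions_def order_trans[of _ 0])
      then show ?thesis ..
    qed
  qed
qed

theorem proposition1:
  fixes \<Gamma> :: "(int ^ 'd::finite) set"
  assumes "rule_set \<Gamma>"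
  defines "cond1 \<equiv> \<forall>\<gamma>\<in>\<Gamma>. \<forall>p\<in>positions. \<forall>q\<in>positions.
      p + q - \<gamma> \<in> positions \<longrightarrow> p - \<gamma> \<in> positions \<or> q - \<gamma> \<in> positions"
    and "cond3 \<equiv> \<forall>\<gamma>\<in>\<Gamma>. card {i. \<gamma> $ i > 0} \<le> 1 \<and> (\<forall>i. \<gamma> $ i > 0 \<longrightarrow> \<gamma> $ i \<le> 1)"
    and "cond4 \<equiv> \<forall>\<gamma>\<in>\<Gamma>. (\<forall>i. pos_part \<gamma> $ i \<in> {0, 1}) \<and> card {i. pos_part \<gamma> $ i = 1} \<le> 1"
    and "cond5 \<equiv> \<forall>\<gamma>\<in>\<Gamma>. (\<exists>!i. \<gamma> $ i > 0) \<and> (\<forall>i. \<gamma> $ i > 0 \<longrightarrow> \<gamma> $ i = 1)"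
  shows "(cond1 \<longleftrightarrow> cond3) \<and> (cond3 \<longleftrightarrow> cond4) \<and> (cond4 \<longleftrightarrow> cond5)"
proof -
  define unit :: "int ^ 'd \<Rightarrow> bool" where
    "unit \<gamma> \<longleftrightarrow> (\<forall>i. \<gamma> $ i > 0 \<longrightarrow> \<gamma> $ i = 1 \<and> (\<forall>j. j \<noteq> i \<longrightarrow> \<gamma> $ j \<le> 0))" for \<gamma>
  have le1: "x \<le> 1 \<longleftrightarrow> x = 1" if "0 < x" for x :: int
    using that by linarith
  have c1: "cond1 \<longleftrightarrow> (\<forall>\<gamma>\<in>\<Gamma>. unit \<gamma>)"
    by (simp add: cond1_def splitting_iff unit_def)
  have unit3: "card {i. \<gamma> $ i > 0} \<le> 1 \<and> (\<forall>i. \<gamma> $ i > 0 \<longrightarrow> \<gamma> $ i \<le> 1) \<longleftrightarrow> unit \<gamma>" for \<gamma>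
  proof -
    have "card {i. \<gamma> $ i > 0} \<le> 1 \<longleftrightarrow> (\<forall>i j. \<gamma> $ i > 0 \<longrightarrow> \<gamma> $ j > 0 \<longrightarrow> i = j)"
      by (auto simp: card_le_Suc0_iff_eq)
    \<comment> \<open>Rewriting \<open>\<gamma> $ j \<le> 0\<close> as the negation of
      \<open>0 < \<gamma> $ j\<close> leaves a single positivity predicate for
      \<open>blast\<close>.\<close>
    then show ?thesis
      unfolding unit_def not_less[symmetric, of _ 0] using le1 by blast
  qed
  have c3: "cond3 \<longleftrightarrow> (\<forall>\<gamma>\<in>\<Gamma>. unit \<gamma>)"
    unfolding cond3_def unit3 ..
  have pos_part_01: "pos_part \<gamma> $ i \<in> {0, 1} \<longleftrightarrow> (\<gamma> $ i > 0 \<longrightarrow> \<gamma> $ i \<le> 1)"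
    and pos_part_1: "pos_part \<gamma> $ i = 1 \<longleftrightarrow> \<gamma> $ i = 1" for \<gamma> :: "int ^ 'd" and i
    by (auto simp: pos_part_def max_def)
  have "(\<forall>i. pos_part \<gamma> $ i \<in> {0, 1}) \<and> card {i. pos_part \<gamma> $ i = 1} \<le> 1 \<longleftrightarrow>
        card {i. \<gamma> $ i > 0} \<le> 1 \<and> (\<forall>i. \<gamma> $ i > 0 \<longrightarrow> \<gamma> $ i \<le> 1)" for \<gamma> :: "int ^ 'd"
  proof -
    \<comment> \<open>The two cardinalities need to agree only under this bound, since both sides of
      the equivalence include it.\<close>
    have "{i. \<gamma> $ i = 1} = {i. \<gamma> $ i > 0}" if "\<forall>i. \<gamma> $ i > 0 \<longrightarrow> \<gamma> $ i \<le> 1"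
      using that le1 by auto
    then show ?thesis
      unfolding pos_part_01 pos_part_1 by auto
  qed
  then have c4: "cond4 \<longleftrightarrow> cond3"
    unfolding cond3_def cond4_def by simp
  \<comment> \<open>\<open>unit\<close> supplies uniqueness and the value 1; existence comes from
    membership in the rule set.\<close>
  have "(\<exists>!i. \<gamma> $ i > 0) \<and> (\<forall>i. \<gamma> $ i > 0 \<longrightarrow> \<gamma> $ i = 1) \<longleftrightarrow> unit \<gamma>" if "\<gamma> \<in> \<Gamma>" for \<gamma>
    using rule_set_pos_entry[OF assms(1) that]
    unfolding unit_def not_less[symmetric, of _ 0] by blast
  then have "cond5 \<longleftrightarrow> (\<forall>\<gamma>\<in>\<Gamma>. unit \<gamma>)"
    unfolding cond5_def by simp
  with c1 c3 c4 show ?thesis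
    by simp
qed

end
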